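(* Let $\mathfrak{N}_2$ be the class of nice sections (of width three) with horizon $2$ and height at least two. The isomorphism type of a poset $P \in \mathfrak{N}_2$ is uniquely determined by the types of its level-pairs $P(k,k+1)$, $k \in [1,h_P-2]$ (each of which is either a 6-crown or of type $3C$); that is, if $P, Q \in \mathfrak{N}_2$ satisfy $h_P = h_Q$ and $P(k,k+1) \simeq Q(k,k+1)$ for all $k \in [1,h_P-2]$, then $P \simeq Q$. In particular, for every integer $n \geq 2$ there exist exactly $2^{n-2}$ isomorphism types of posets of height $n$ in $\mathfrak{N}_2$. Furthermore, for every $P \in \mathfrak{N}_2$, every permutation of $P(0)$ can be uniquely extended to an automorphism of $P$.
   Context: All posets are finite. $[i,j] = \{i,\dots,j\}$ for integers. The height $h_P$ of a poset $P$ is the maximal length (cardinality minus one) of a chain in $P$. Level sets: $P(0) := \min P$ and $P(k+1) := \min(P \setminus \bigcup_{i=0}^k P(i))$ for $0 \le k < h_P$. For $k \le \ell$, $P(k,\ell) := P(k) \cup P(\ell)$; subsets are identified with the induced sub-posets. A 6-crown is a poset with six points $x_{i,j}$, $i \in \{0,1,2\}$, $j \in \{0,1\}$, whose only comparabilities between different points are $x_{0,0} < x_{0,1} > x_{1,0} < x_{1,1} > x_{2,0} < x_{2,1} > x_{0,0}$. A poset is of type $33$ if it is the ordinal sum of two 3-element antichains, and of type $3C$ if it consists of three disjoint two-element chains without further comparabilities between different points. A section of width three is a poset $P$ of height at least one with carrier $\{c_{k,j} : k \in [0,h_P], j \in \{0,1,2\}\}$ such that: $c_{0,j} < \cdots <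 c_{h_P,j}$ is a chain for each $j$; $\{c_{k,0},c_{k,1},c_{k,2}\}$ is an antichain for each $k$; the map $c_{k,j} \mapsto c_{k,(j+1) \bmod 3}$ is an automorphism of $P$; and $P(k,k+1) \not\simeq 33$ for all $k \in [0,h_P-1]$. (Then $P(k) = \{c_{k,0},c_{k,1},c_{k,2}\}$, and two consecutive levels form a 6-crown or are of type $3C$.) A point is irreducible if it has exactly one lower cover or exactly one upper cover. A section is nice if it contains no irreducible point. A crowned section is a section $P$ of width three for which $P(0,1)$ and $P(h_P-1,h_P)$ are 6-crowns; every nice section of width three is crowned. The horizon of a crowned section $P$ with $h_P \geq 2$ is the smallest positive integer $\eta$ with $P(k,k+\eta) \simeq 33$ for all $k \in [0,h_P-\eta]$. *)

theory Defs
  imports Main "HOL-Combinatorics.Permutations"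
begin

text \<open>
  A finite poset is represented by its reflexive order relation \<open>P\<close>, that is, by a relation with
  \<open>Partial_order P\<close> and \<open>finite (Field P)\<close>; its carrier is \<open>Field P\<close>, and the sub-poset induced
  on \<open>A\<close> is \<open>Restr P A\<close>.  The library predicate \<open>iso\<close> is introduced for well-orders, but by
  \<open>iso_iff2\<close> it is order isomorphism for arbitrary relations.
\<close>

definition poset_iso :: "'a rel \<Rightarrow> 'b rel \<Rightarrow> bool" (infix "\<simeq>" 50)
  where "P \<simeq> Q \<longleftrightarrow> (\<exists>f. iso P Q f)"

definition height :: "'a rel \<Rightarrow> nat"
  where "height P = Max (card ` Chains P) - 1"

definition minimals :: "'a rel \<Rightarrow> 'a set \<Rightarrow> 'a set"
  where "minimals P A = {x \<in> A. \<forall>y \<in> A. (y, x) \<in> P \<longrightarrow> y = x}"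

text \<open>The level sets \<open>P(k)\<close>; they are empty for \<open>k > height P\<close>.\<close>

function level :: "'a rel \<Rightarrow> nat \<Rightarrow> 'a set"
  where "level P k = minimals P (Field P - (\<Union>i\<in>{..<k}. level P i))"
  by auto
termination by (relation "measure snd") auto

declare level.simps [simp del]

definition level_pair :: "'a rel \<Rightarrow> nat \<Rightarrow> nat \<Rightarrow> 'a rel"
  where "level_pair P k l = Restr P (level P k \<union> level P l)"

definition six_crown :: "'a rel \<Rightarrow> bool"
  where "six_crown P \<longleftrightarrow>
    (\<exists>x :: nat \<Rightarrow> nat \<Rightarrow> 'a.
      inj_on (\<lambda>(i, j). x i j) ({0, 1, 2} \<times> {0, 1}) \<and>
      P = Id_on ((\<lambda>(i, j). x i j) ` ({0, 1, 2} \<times> {0, 1})) \<union>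
          {(x 0 0, x 0 1), (x 1 0, x 0 1), (x 1 0, x 1 1),
           (x 2 0, x 1 1), (x 2 0, x 2 1), (x 0 0, x 2 1)})"

definition type_33 :: "'a rel \<Rightarrow> bool"
  where "type_33 P \<longleftrightarrow>
    (\<exists>A B. card A = 3 \<and> card B = 3 \<and> A \<inter> B = {} \<and> P = Id_on (A \<union> B) \<union> A \<times> B)"

definition type_3C :: "'a rel \<Rightarrow> bool"
  where "type_3C P \<longleftrightarrow>
    (\<exists>x :: nat \<Rightarrow> nat \<Rightarrow> 'a.
      inj_on (\<lambda>(i, j). x i j) ({0, 1, 2} \<times> {0, 1}) \<and>
      P = Id_on ((\<lambda>(i, j). x i j) ` ({0, 1, 2} \<times> {0, 1})) \<union>
          {(x 0 0, x 0 1), (x 1 0, x 1 1), (x 2 0, x 2 1)})"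

text \<open>
  The points \<open>c k j\<close> are required to be pairwise distinct, so that every \<open>{c k 0, c k 1, c k 2}\<close>
  is a three-element antichain.  The labelling \<open>c\<close> is not part of the structure.
\<close>

definition width3_section :: "'a rel \<Rightarrow> bool"
  where "width3_section P \<longleftrightarrow>
    Partial_order P \<and> finite (Field P) \<and> height P \<ge> 1 \<and>
    (\<exists>c :: nat \<Rightarrow> nat \<Rightarrow> 'a.
      inj_on (\<lambda>(k, j). c k j) ({0..height P} \<times> {0, 1, 2}) \<and>
      Field P = (\<lambda>(k, j). c k j) ` ({0..height P} \<times> {0, 1, 2}) \<and>
      (\<forall>j \<in> {0, 1, 2}. \<forall>k < height P. (c k j, c (k + 1) j) \<in> P) \<and>
      (\<forall>k \<in> {0..height P}. \<forall>i \<in> {0, 1, 2}. \<forall>j \<in> {0, 1, 2}. (c k i, c k j) \<in> P \<longrightarrow> i = j) \<and>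
      (\<exists>f. iso P P f \<and>
        (\<forall>k \<in> {0..height P}. \<forall>j \<in> {0, 1, 2}. f (c k j) = c k ((j + 1) mod 3)))) \<and>
    (\<forall>k < height P. \<not> type_33 (level_pair P k (k + 1)))"

text \<open>\<open>covered_by P x y\<close>: \<open>x\<close> is a lower cover of \<open>y\<close>, and \<open>y\<close> is an upper cover of \<open>x\<close>.\<close>

definition covered_by :: "'a rel \<Rightarrow> 'a \<Rightarrow> 'a \<Rightarrow> bool"
  where "covered_by P x y \<longleftrightarrow>
    (x, y) \<in> P \<and> x \<noteq> y \<and> (\<forall>z. (x, z) \<in> P \<and> (z, y) \<in> P \<longrightarrow> z = x \<or> z = y)"

definition irreducible_point :: "'a rel \<Rightarrow> 'a \<Rightarrow> bool"
  where "irreducible_point P x \<longleftrightarrow>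
    x \<in> Field P \<and> ((\<exists>!y. covered_by P y x) \<or> (\<exists>!y. covered_by P x y))"

definition nice_section :: "'a rel \<Rightarrow> bool"
  where "nice_section P \<longleftrightarrow> width3_section P \<and> (\<forall>x. \<not> irreducible_point P x)"

text \<open>
  The condition \<open>k + \<eta> \<le> height P\<close> is \<open>k \<in> [0, height P - \<eta>]\<close> with integer subtraction.  The notion
  is meant for sections of height at least two whose bottom and top level pairs are 6-crowns;
  every nice section of height at least two is of this kind.
\<close>

definition horizon :: "'a rel \<Rightarrow> nat"
  where "horizon P =
    (LEAST \<eta>. \<eta> \<ge> 1 \<and> (\<forall>k. k + \<eta> \<le> height P \<longrightarrow> type_33 (level_pair P k (k + \<eta>))))"

definition N2 :: "'a rel set"
  where "N2 = {P. nice_section P \<and> height P \<ge> 2 \<and> horizon P = 2}"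

text \<open>
  The isomorphism types of the posets in \<open>\<C>\<close>, as equivalence classes.  For \<open>\<C>\<close> consisting of
  posets with carrier in \<open>nat\<close> this loses nothing, since every finite poset has an isomorphic
  copy there.
\<close>

definition iso_types :: "'a rel set \<Rightarrow> 'a rel set set"
  where "iso_types \<C> = \<C> // {(P, Q). P \<simeq> Q}"

end

theory Submission
  imports Defs "HOL-Library.Nat_Bijection"
begin

text \<open>
  Everything follows from a normal form.  Horizon two makes all pairs of levels at distance at least
  two complete, so that only the pairs of consecutive levels carry information.  Each of these is
  a 6-crown or of type \<open>3C\<close>, and both shapes amount to a perfect matching between the two levels:
  in type \<open>3C\<close> comparable points are matched, in a crown incomparable ones.  Identifying matched points
  names the points of each level by three columns, and the poset becomes a \<open>tower\<close>: a grid
  of rows and columns whose order is fixed by the list of types of its consecutive pairs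
  (\<open>tower_labelling\<close>, \<open>N2_labelling\<close>).

  Conversely a tower of height at least two with crowns at both ends is a nice section with horizon
  two, whatever the types in between (\<open>in_N2\<close>).  Irreducible points arise only from a pair of type
  \<open>3C\<close> at the bottom or at the top: a point below an inner pair of type \<open>3C\<close> has a single cover in
  the next level, but further covers two levels up, and dually (\<open>tower_irreducible_point\<close>).

  Two posets with the same types have the same tower, hence are isomorphic (\<open>N2_iso\<close>); as the
  types are recovered from the level pairs, there are as many isomorphism types as there are
  choices for the \<open>n - 2\<close> inner pairs (\<open>card_iso_types_N2\<close>).  Permuting the columns is an automorphism
  of a tower, and a labelling is determined by its bottom row because matched points are recognisable
  from the order (\<open>labelling_unique\<close>); together these give the unique extension of permutations
  (\<open>N2_automorphism\<close>).
\<close>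

section \<open>Isomorphisms and covers\<close>

lemma iso_inverse:
  assumes "iso P Q f"
  shows "iso Q P (inv_into (Field P) f)"
proof -
  have f: "bij_betw f (Field P) (Field Q)"
    and r: "\<And>a b. a \<in> Field P \<Longrightarrow> b \<in> Field P \<Longrightarrow> (a, b) \<in> P \<longleftrightarrow> (f a, f b) \<in> Q"
    using assms by (auto simp: iso_iff2)
  have g: "bij_betw (inv_into (Field P) f) (Field Q) (Field P)"
    by (rule bij_betw_inv_into[OF f])
  have "(x, y) \<in> Q \<longleftrightarrow> (inv_into (Field P) f x, inv_into (Field P) f y) \<in> P"
    if "x \<in> Field Q" "y \<in> Field Q" for x y
  proof -
    have "inv_into (Field P) f x \<in> Field P" "inv_into (Field P) f y \<in> Field P"
      using that bij_betw_apply[OF g] by auto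
    with that r show ?thesis by (simp add: bij_betw_inv_into_right[OF f])
  qed
  with g show ?thesis by (simp add: iso_iff2)
qed

lemma iso_converse:
  "iso P Q f \<Longrightarrow> iso (P\<inverse>) (Q\<inverse>) f"
  by (simp add: iso_iff2)

lemma iso_imp_card_eq:
  assumes "iso P Q f"
  shows "card P = card Q"
proof -
  have f: "inj_on f (Field P)" "f ` Field P = Field Q"
    and r: "\<And>a b. a \<in> Field P \<Longrightarrow> b \<in> Field P \<Longrightarrow> (a, b) \<in> P \<longleftrightarrow> (f a, f b) \<in> Q"
    using assms by (auto simp: iso_iff2 bij_betw_def)
  have "inj_on (map_prod f f) P"
    using f(1) by (fastforce simp: inj_on_def Field_def)
  moreover have "map_prod f f ` P = Q"
  proof (rule set_eqI, clarify)
    fix x y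
    show "(x, y) \<in> map_prod f f ` P \<longleftrightarrow> (x, y) \<in> Q"
    proof
      assume "(x, y) \<in> Q"
      then have "x \<in> f ` Field P" "y \<in> f ` Field P" unfolding f(2) by (auto simp: Field_def)
      with r \<open>(x, y) \<in> Q\<close> show "(x, y) \<in> map_prod f f ` P" by force
    next
      assume "(x, y) \<in> map_prod f f ` P"
      then show "(x, y) \<in> Q" using r by (auto simp: Field_def)
    qed
  qed
  ultimately show ?thesis using card_image by metis
qed

lemma covered_by_converse: "covered_by (P\<inverse>) x y \<longleftrightarrow> covered_by P y x"
  by (auto simp: covered_by_def)

lemma covered_by_in_Field: "covered_by P x y \<Longrightarrow> x \<in> Field P \<and> y \<in> Field P"
  by (auto simp: covered_by_def Field_def)

lemma iso_covered_by:
  assumes "iso P Q f" "x \<in> Field P" "y \<in> Field P"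
  shows "covered_by Q (f x) (f y) \<longleftrightarrow> covered_by P x y"
proof -
  have f: "inj_on f (Field P)" "f ` Field P = Field Q"
    and r: "\<And>a b. a \<in> Field P \<Longrightarrow> b \<in> Field P \<Longrightarrow> (a, b) \<in> P \<longleftrightarrow> (f a, f b) \<in> Q"
    using assms by (auto simp: iso_iff2 bij_betw_def)
  have "(\<forall>z. (f x, z) \<in> Q \<and> (z, f y) \<in> Q \<longrightarrow> z = f x \<or> z = f y) \<longleftrightarrow>
        (\<forall>z\<in>Field Q. (f x, z) \<in> Q \<and> (z, f y) \<in> Q \<longrightarrow> z = f x \<or> z = f y)"
    by (auto simp: Field_def)
  also have "\<dots> \<longleftrightarrow> (\<forall>z\<in>Field P. (x, z) \<in> P \<and> (z, y) \<in> P \<longrightarrow> z = x \<or> z = y)"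
    unfolding f(2)[symmetric] using r assms(2,3) f(1) by (auto simp: inj_on_eq_iff)
  also have "\<dots> \<longleftrightarrow> (\<forall>z. (x, z) \<in> P \<and> (z, y) \<in> P \<longrightarrow> z = x \<or> z = y)"
    by (auto simp: Field_def)
  finally show ?thesis
    unfolding covered_by_def using r assms(2,3) f(1) by (auto simp: inj_on_eq_iff)
qed

lemma Ex1_iff_card: "(\<exists>!y. R y) \<longleftrightarrow> card {y. R y} = 1"
  by (auto simp: card_1_singleton_iff set_eq_iff)

lemma iso_unique_upper_cover:
  assumes "iso P Q f" "x \<in> Field P"
  shows "(\<exists>!y. covered_by Q (f x) y) \<longleftrightarrow> (\<exists>!y. covered_by P x y)"
proof -
  have f: "inj_on f (Field P)" "f ` Field P = Field Q"
    using assms by (auto simp: iso_iff2 bij_betw_def)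
  have *: "{y. covered_by Q (f x) y} = f ` {y. covered_by P x y}"
  proof (intro set_eqI iffI)
    fix z assume "z \<in> {y. covered_by Q (f x) y}"
    then have z: "covered_by Q (f x) z" by simp
    then have "z \<in> f ` Field P" unfolding f(2) using covered_by_in_Field by metis
    then show "z \<in> f ` {y. covered_by P x y}"
      using z iso_covered_by[OF assms] by auto
  qed (use iso_covered_by[OF assms] covered_by_in_Field in fastforce)
  have "inj_on f {y. covered_by P x y}"
    using f(1) by (rule inj_on_subset) (auto dest: covered_by_in_Field)
  then have "card {y. covered_by Q (f x) y} = card {y. covered_by P x y}"
    unfolding * by (rule card_image)
  then show ?thesis by (simp add: Ex1_iff_card)
qed

lemma iso_irreducible_point:
  assumes "iso P Q f"
  shows "(\<exists>x. irreducible_point Q x) \<longleftrightarrow> (\<exists>x. irreducible_point P x)"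
proof -
  have "irreducible_point Q (f x) \<longleftrightarrow> irreducible_point P x" if "x \<in> Field P" for x
    using that iso_unique_upper_cover[OF assms that]
      iso_unique_upper_cover[OF iso_converse[OF assms], of x] iso_Field[OF assms]
    by (auto simp: irreducible_point_def covered_by_converse)
  moreover have "Field Q = f ` Field P" using iso_Field[OF assms] by simp
  ultimately show ?thesis by (metis irreducible_point_def image_iff)
qed

section \<open>Towers\<close>

definition grid :: "nat \<Rightarrow> (nat \<times> nat) set"
  where "grid n = {0..n} \<times> {0, 1, 2}"

text \<open>
  A crown is the complement of a perfect matching between two rows, and a pair of type \<open>3C\<close> is
  such a matching.  The condition \<open>t k \<longleftrightarrow> i \<noteq> j\<close> covers both: \<open>t k\<close> says that the rows \<open>k\<close> and
  \<open>k + 1\<close> form a crown.  In either case points with equal second coordinate are partners in the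
  matching, so the second coordinate names one column of the matchings composed.
\<close>

definition tower :: "nat \<Rightarrow> (nat \<Rightarrow> bool) \<Rightarrow> (nat \<times> nat) rel"
  where "tower n t = {((k, i), (l, j)). (k, i) \<in> grid n \<and> (l, j) \<in> grid n \<and>
    (k = l \<and> i = j \<or> l = k + 1 \<and> (t k \<longleftrightarrow> i \<noteq> j) \<or> k + 2 \<le> l)}"

lemma tower_iff:
  "((k, i), (l, j)) \<in> tower n t \<longleftrightarrow> k \<le> n \<and> l \<le> n \<and> i \<in> {0, 1, 2} \<and> j \<in> {0, 1, 2} \<and>
    (k = l \<and> i = j \<or> l = k + 1 \<and> (t k \<longleftrightarrow> i \<noteq> j) \<or> k + 2 \<le> l)"
  by (auto simp: tower_def grid_def)

lemma Field_tower: "Field (tower n t) = grid n"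
proof
  show "Field (tower n t) \<subseteq> grid n" by (auto simp: Field_def tower_def)
  show "grid n \<subseteq> Field (tower n t)"
  proof
    fix p assume "p \<in> grid n"
    then have "(p, p) \<in> tower n t" by (auto simp: tower_def grid_def)
    then show "p \<in> Field (tower n t)" by (auto simp: Field_def)
  qed
qed

lemma tower_cong:
  assumes "\<And>k. k < n \<Longrightarrow> t k = t' k"
  shows "tower n t = tower n t'"
proof -
  have "k < n" if "(k + 1, j) \<in> grid n" for k j using that by (simp add: grid_def)
  with assms show ?thesis unfolding tower_def by (intro Collect_cong) auto
qed

lemma bij_betw_rotate3: "bij_betw (\<lambda>j. (j + u) mod 3) {0, 1, 2} {0, 1, 2 :: nat}"
proof -
  have "inj_on (\<lambda>j. (j + u) mod 3) {0, 1, 2 :: nat}"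
  proof (rule inj_onI)
    fix i j :: nat assume ij: "i \<in> {0, 1, 2}" "j \<in> {0, 1, 2}" and "(i + u) mod 3 = (j + u) mod 3"
    then have eq: "(i + u mod 3) mod 3 = (j + u mod 3) mod 3" by (simp only: mod_add_right_eq)
    have "u mod 3 \<in> {0, 1, 2}" by auto
    with ij eq show "i = j" by auto
  qed
  moreover have "(\<lambda>j. (j + u) mod 3) ` {0, 1, 2} \<subseteq> {0, 1, 2 :: nat}" by auto
  ultimately show ?thesis
    unfolding bij_betw_def by (metis endo_inj_surj finite.simps)
qed

lemma bij_betw_grid:
  assumes "\<And>k. k \<le> n \<Longrightarrow> bij_betw (\<rho> k) {0, 1, 2} {0, 1, 2}"
  shows "bij_betw (\<lambda>(k, i). (k, \<rho> k i)) (grid n) (grid n)"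
proof -
  have "inj_on (\<lambda>(k, i). (k, \<rho> k i)) (grid n)"
  proof (rule inj_onI, clarsimp)
    fix k i j assume "(k, i) \<in> grid n" "(k, j) \<in> grid n" and eq: "\<rho> k i = \<rho> k j"
    then have "k \<le> n" "i \<in> {0, 1, 2}" "j \<in> {0, 1, 2}" unfolding grid_def by auto
    then show "i = j" using inj_onD[OF bij_betw_imp_inj_on[OF assms] eq] by blast
  qed
  moreover have "(\<lambda>(k, i). (k, \<rho> k i)) ` grid n \<subseteq> grid n"
    unfolding grid_def using bij_betw_apply[OF assms] by fastforce
  moreover have "finite (grid n)" by (simp add: grid_def)
  ultimately show ?thesis by (simp add: bij_betw_def endo_inj_surj)
qed

text \<open>
  Whether two points are comparable depends on their second coordinates only through equality; this
  is the source of all automorphisms.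
\<close>

lemma tower_permute:
  assumes "bij_betw \<rho> {0, 1, 2} {0, 1, 2}"
  shows "iso (tower n t) (tower n t) (\<lambda>(k, i). (k, \<rho> i))"
proof -
  have "bij_betw (\<lambda>(k, i). (k, \<rho> i)) (grid n) (grid n)"
    using assms by (rule bij_betw_grid)
  moreover have "((k, i), (l, j)) \<in> tower n t \<longleftrightarrow> ((k, \<rho> i), (l, \<rho> j)) \<in> tower n t"
    if "(k, i) \<in> grid n" "(l, j) \<in> grid n" for k i l j
  proof -
    have ij: "i \<in> {0, 1, 2}" "j \<in> {0, 1, 2}" using that by (auto simp: grid_def)
    then have "\<rho> i = \<rho> j \<longleftrightarrow> i = j"
      by (rule inj_on_eq_iff[OF bij_betw_imp_inj_on[OF assms]])
    moreover have "\<rho> i \<in> {0, 1, 2}" "\<rho> j \<in> {0, 1, 2}"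
      using ij bij_betw_apply[OF assms] by (simp_all only:)
    ultimately show ?thesis using ij by (simp only: tower_iff simp_thms)
  qed
  ultimately show ?thesis
    unfolding iso_iff2 Field_tower by auto
qed

text \<open>
  Passing to the order dual reduces statements about lower covers to statements about upper covers.
\<close>

lemma tower_dual:
  "iso (tower n t) ((tower n (\<lambda>k. t (n - 1 - k)))\<inverse>) (\<lambda>(k, i). (n - k, i))"
proof -
  have "bij_betw (\<lambda>(k, i). (n - k, i)) (grid n) (grid n)"
    by (rule bij_betwI[where g = "\<lambda>(k, i). (n - k, i)"]) (auto simp: grid_def)
  moreover have "((k, i), (l, j)) \<in> tower n t \<longleftrightarrow>
      ((n - l, j), (n - k, i)) \<in> tower n (\<lambda>k. t (n - 1 - k))"
    if "(k, i) \<in> grid n" "(l, j) \<in> grid n" for k i l j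
  proof -
    have b: "k \<le> n" "l \<le> n" "i \<in> {0, 1, 2}" "j \<in> {0, 1, 2}"
      using that by (auto simp: grid_def)
    then have eq: "n - l = n - k \<longleftrightarrow> k = l" "n - k = n - l + 1 \<longleftrightarrow> l = k + 1"
      "n - l + 2 \<le> n - k \<longleftrightarrow> k + 2 \<le> l" "l = k + 1 \<Longrightarrow> n - 1 - (n - l) = k"
      by linarith+
    show ?thesis
    proof (cases "l = k + 1")
      case True
      with b eq(4) show ?thesis unfolding tower_iff eq(1-3) by (simp only:) auto
    next
      case False
      with b show ?thesis unfolding tower_iff eq(1-3) by (simp only:) auto
    qed
  qed
  ultimately show ?thesis
    unfolding iso_iff2 Field_tower Field_converse by auto
qed

lemma tower_partial_order: "Partial_order (tower n t)"
proof -
  have "trans (tower n t)"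
  proof (rule transI, clarify)
    fix k i l j m h
    assume "((k, i), (l, j)) \<in> tower n t" "((l, j), (m, h)) \<in> tower n t"
    then show "((k, i), (m, h)) \<in> tower n t" unfolding tower_def by auto
  qed
  moreover have "antisym (tower n t)"
    by (rule antisymI) (auto simp: tower_def)
  moreover have "Refl (tower n t)"
    unfolding refl_on_def Field_tower by (auto simp: tower_def)
  ultimately show ?thesis
    using Restr_Field[of "tower n t"] by (auto simp: partial_order_on_def preorder_on_def)
qed

text \<open>
  Three situations occur below the top row.  In a crown a point has two upper covers in the next row.
  If the next pair is of type \<open>3C\<close> and a further row exists, the unique point \<open>(k + 1, i)\<close> above
  \<open>(k, i)\<close> in the next row is one cover, and any point two rows up that is not above \<open>(k + 1, i)\<close>
  is another.  Only a pair of type \<open>3C\<close> at the very top leaves a single cover.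
\<close>

lemma tower_unique_upper_cover:
  "(\<exists>p \<in> grid n. \<exists>!q. covered_by (tower n t) p q) \<longleftrightarrow> n \<ge> 1 \<and> \<not> t (n - 1)"
proof
  have next_cover: "covered_by (tower n t) (k, i) (Suc k, j)"
    if "k < n" "i \<in> {0, 1, 2}" "j \<in> {0, 1, 2}" "t k \<longleftrightarrow> i \<noteq> j" for k i j
  proof -
    have "((k, i), (Suc k, j)) \<in> tower n t" using that by (simp add: tower_iff)
    then show ?thesis unfolding covered_by_def by (auto simp: tower_def)
  qed
  assume "\<exists>p \<in> grid n. \<exists>!q. covered_by (tower n t) p q"
  then obtain k i where ki: "(k, i) \<in> grid n" and unique: "\<exists>!q. covered_by (tower n t) (k, i) q"
    by auto
  have "k \<noteq> n"
  proof
    assume "k = n"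
    then have "\<not> covered_by (tower n t) (k, i) q" for q
      by (cases q) (auto simp: covered_by_def tower_def grid_def)
    with unique show False by blast
  qed
  with ki have k: "k < n" "i \<in> {0, 1, 2}" by (auto simp: grid_def)
  have "\<not> t k"
  proof
    assume "t k"
    have "\<exists>a \<in> {0, 1, 2}. \<exists>b \<in> {0, 1, 2}. a \<noteq> b \<and> a \<noteq> i \<and> b \<noteq> i"
      using k(2) by auto
    then obtain a b where "a \<in> {0, 1, 2}" "b \<in> {0, 1, 2}" "a \<noteq> b" "a \<noteq> i" "b \<noteq> i"
      by blast
    then have "covered_by (tower n t) (k, i) (Suc k, a)" "covered_by (tower n t) (k, i) (Suc k, b)"
      using k \<open>t k\<close> by (auto intro!: next_cover simp del: insert_iff)
    with unique \<open>a \<noteq> b\<close> show False by (metis prod.inject)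
  qed
  moreover have "k = n - 1"
  proof (rule ccontr)
    assume "k \<noteq> n - 1"
    with k have k2: "k + 2 \<le> n" by simp
    have 1: "covered_by (tower n t) (k, i) (Suc k, i)"
      using k \<open>\<not> t k\<close> by (auto intro!: next_cover simp del: insert_iff)
    \<comment> \<open>the column of a point two rows up that is not above \<open>(k + 1, i)\<close>\<close>
    have "\<exists>j \<in> {0, 1, 2}. \<not> (t (k + 1) \<longleftrightarrow> i \<noteq> j)"
      using k(2) by (cases "t (k + 1)"; cases "i = 0") auto
    then obtain j where j: "j \<in> {0, 1, 2}" "\<not> (t (k + 1) \<longleftrightarrow> i \<noteq> j)" ..
    have "(k, i) \<in> grid n" "(Suc (Suc k), j) \<in> grid n" using k k2 j(1) by (auto simp: grid_def)
    then have "covered_by (tower n t) (k, i) (k + 2, j)"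
      using j(2) \<open>\<not> t k\<close> unfolding covered_by_def by (auto simp: tower_def)
    with 1 unique have "(Suc k, i) = (k + 2, j)" by blast
    then show False by simp
  qed
  ultimately show "n \<ge> 1 \<and> \<not> t (n - 1)" using k by auto
next
  assume n: "n \<ge> 1 \<and> \<not> t (n - 1)"
  then obtain m where m: "n = Suc m" "\<not> t m" by (cases n) auto
  have grid: "(m, 0) \<in> grid n" "(n, 0) \<in> grid n" using m by (auto simp: grid_def)
  have "covered_by (tower n t) (m, 0) q \<longleftrightarrow> q = (n, 0)" for q
  proof (cases q)
    case (Pair l j)
    have "l \<le> Suc m" if "(l, j) \<in> grid n" using that m by (simp add: grid_def)
    then have "covered_by (tower n t) (m, 0) (l, j) \<Longrightarrow> l = n \<and> j = 0"
      using m by (auto simp: covered_by_def tower_def)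
    moreover have "covered_by (tower n t) (m, 0) (n, 0)"
      using m grid by (auto simp: covered_by_def tower_def)
    ultimately show ?thesis using Pair by auto
  qed
  then have "\<exists>!q. covered_by (tower n t) (m, 0) q" by simp
  with grid(1) show "\<exists>p \<in> grid n. \<exists>!q. covered_by (tower n t) p q" ..
qed

lemma tower_irreducible_point:
  assumes "n \<ge> 1"
  shows "(\<exists>p. irreducible_point (tower n t) p) \<longleftrightarrow> \<not> t 0 \<or> \<not> t (n - 1)"
proof -
  let ?t = "\<lambda>k. t (n - 1 - k)"
  have "(\<exists>q \<in> grid n. \<exists>!p. covered_by (tower n t) p q) \<longleftrightarrow> \<not> t 0"
  proof -
    have "(\<exists>q \<in> grid n. \<exists>!p. covered_by (tower n t) p q) \<longleftrightarrow>
        (\<exists>q \<in> Field (tower n ?t). \<exists>!p. covered_by (tower n ?t) q p)"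
    proof -
      have iso: "iso ((tower n t)\<inverse>) (tower n ?t) (\<lambda>(k, i). (n - k, i))" (is "iso _ _ ?r")
        using iso_converse[OF tower_dual[of n t]] by simp
      have r: "?r ` grid n = grid n" using iso_Field[OF iso] by (simp add: Field_tower)
      have "(\<exists>q \<in> grid n. \<exists>!p. covered_by (tower n t) p q) \<longleftrightarrow>
          (\<exists>q \<in> grid n. \<exists>!p. covered_by (tower n ?t) (?r q) p)"
        using iso_unique_upper_cover[OF iso]
        by (intro bex_cong) (auto simp: Field_tower covered_by_converse)
      also have "\<dots> \<longleftrightarrow> (\<exists>q \<in> ?r ` grid n. \<exists>!p. covered_by (tower n ?t) q p)" by blast
      finally show ?thesis unfolding r Field_tower .
    qed
    then show ?thesis using tower_unique_upper_cover[of n ?t] assms by (simp add: Field_tower)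
  qed
  moreover have "(\<exists>p \<in> grid n. \<exists>!q. covered_by (tower n t) p q) \<longleftrightarrow> \<not> t (n - 1)"
    using tower_unique_upper_cover assms by simp
  ultimately show ?thesis unfolding irreducible_point_def Field_tower by blast
qed

section \<open>Level sets and the types of level pairs\<close>

text \<open>
  If antichains never reach down into earlier ones and each of their points dominates something in
  every earlier one, they are the level sets: after the removal of the earlier ones, what is
  minimal is the next one.
\<close>

locale row_decomposition =
  fixes P :: "'a rel" and n :: nat and L :: "nat \<Rightarrow> 'a set"
  assumes refl: "x \<in> Field P \<Longrightarrow> (x, x) \<in> P"
    and field: "Field P = (\<Union>k\<in>{..n}. L k)"
    and antichain: "k \<le> n \<Longrightarrow> x \<in> L k \<Longrightarrow> y \<in> L k \<Longrightarrow> (x, y) \<in> P \<Longrightarrow> x = y"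
    and not_down: "k < l \<Longrightarrow> l \<le> n \<Longrightarrow> x \<in> L l \<Longrightarrow> y \<in> L k \<Longrightarrow> (x, y) \<notin> P"
    and above: "k < l \<Longrightarrow> l \<le> n \<Longrightarrow> y \<in> L l \<Longrightarrow> \<exists>x \<in> L k. (x, y) \<in> P"
begin

lemma level_eq:
  assumes "k \<le> n"
  shows "level P k = L k"
  using assms
proof (induction k rule: less_induct)
  case (less k)
  have disjoint: "x \<notin> L i" if "x \<in> L j" "i < j" "j \<le> n" for x i j
  proof
    assume "x \<in> L i"
    then have "(x, x) \<notin> P" by (rule not_down[OF that(2,3,1)])
    moreover have "x \<in> Field P" using that field by auto
    ultimately show False using refl by blast
  qed
  have "(\<Union>i\<in>{..<k}. level P i) = (\<Union>i\<in>{..<k}. L i)" using less by auto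
  then have rest: "Field P - (\<Union>i\<in>{..<k}. level P i) = (\<Union>m\<in>{k..n}. L m)"
  proof (intro set_eqI iffI)
    fix x assume "x \<in> (\<Union>m\<in>{k..n}. L m)"
    then obtain m where m: "k \<le> m" "m \<le> n" "x \<in> L m" by auto
    then have "x \<in> Field P" using field by auto
    moreover have "x \<notin> L i" if "i < k" for i using disjoint[of x m i] m that by auto
    ultimately show "x \<in> Field P - (\<Union>i\<in>{..<k}. level P i)" using less by auto
  next
    fix x assume x: "x \<in> Field P - (\<Union>i\<in>{..<k}. level P i)"
    then obtain m where m: "m \<le> n" "x \<in> L m" using field by auto
    have "k \<le> m" using x m less by (cases "k \<le> m") auto
    with m show "x \<in> (\<Union>m\<in>{k..n}. L m)" by auto
  qed
  have "minimals P (\<Union>m\<in>{k..n}. L m) = L k"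
  proof (intro set_eqI iffI)
    fix x assume "x \<in> minimals P (\<Union>m\<in>{k..n}. L m)"
    then obtain m where m: "k \<le> m" "m \<le> n" "x \<in> L m"
      and min: "\<forall>i\<in>{k..n}. \<forall>y\<in>L i. (y, x) \<in> P \<longrightarrow> y = x"
      unfolding minimals_def by auto
    show "x \<in> L k"
    proof (cases "m = k")
      case False
      with m above[of k m x] obtain y where "y \<in> L k" "(y, x) \<in> P" by auto
      with min less.prems show ?thesis by auto
    qed (use m in simp)
  next
    fix x assume x: "x \<in> L k"
    have "y = x" if "k \<le> m" "m \<le> n" "y \<in> L m" "(y, x) \<in> P" for y m
      using that x antichain[of k y x] not_down[of k m y x] by (cases "m = k") auto
    with x less.prems show "x \<in> minimals P (\<Union>m\<in>{k..n}. L m)" by (auto simp: minimals_def)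
  qed
  with rest show ?case by (subst level.simps) simp
qed

lemma level_pair_eq:
  assumes "k < l" "l \<le> n"
  shows "level_pair P k l = Id_on (L k \<union> L l) \<union> P \<inter> L k \<times> L l"
proof -
  have "L k \<subseteq> Field P" "L l \<subseteq> Field P"
    unfolding field using assms by (intro UN_upper; simp)+
  then have "(x, x) \<in> P" if "x \<in> L k \<union> L l" for x using that refl by blast
  moreover have "x = y" if "x \<in> L k" "y \<in> L k" "(x, y) \<in> P" for x y
    using antichain[of k x y] assms that by simp
  moreover have "x = y" if "x \<in> L l" "y \<in> L l" "(x, y) \<in> P" for x y
    using antichain[of l x y] assms that by simp
  moreover have "(y, x) \<notin> P" if "x \<in> L k" "y \<in> L l" for x y
    by (rule not_down[OF assms that(2,1)])
  ultimately have "Restr P (L k \<union> L l) = Id_on (L k \<union> L l) \<union> P \<inter> L k \<times> L l"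
    by (intro equalityI subrelI) (simp_all add: Id_on_iff, blast+)
  then show ?thesis using assms by (simp add: level_pair_def level_eq)
qed

end

text \<open>
  The cardinality of the order relation separates the three types of pairs and is an isomorphism
  invariant, which spares a comparison of the shapes themselves.
\<close>

lemma card_six_crown:
  assumes "six_crown R"
  shows "card R = 12"
proof -
  obtain x :: "nat \<Rightarrow> nat \<Rightarrow> 'a"
    where "inj_on (\<lambda>(i, j). x i j) ({0, 1, 2} \<times> {0, 1})"
      and R: "R = Id_on ((\<lambda>(i, j). x i j) ` ({0, 1, 2} \<times> {0, 1})) \<union>
          {(x 0 0, x 0 1), (x 1 0, x 0 1), (x 1 0, x 1 1),
           (x 2 0, x 1 1), (x 2 0, x 2 1), (x 0 0, x 2 1)}"
    using assms unfolding six_crown_def by auto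
  then have d: "distinct [x 0 0, x 0 1, x 1 0, x 1 1, x 2 0, x 2 1]"
    by (simp add: inj_on_def eq_commute)
  have "R = {(x 0 0, x 0 0), (x 0 1, x 0 1), (x 1 0, x 1 0), (x 1 1, x 1 1), (x 2 0, x 2 0),
      (x 2 1, x 2 1), (x 0 0, x 0 1), (x 1 0, x 0 1), (x 1 0, x 1 1),
      (x 2 0, x 1 1), (x 2 0, x 2 1), (x 0 0, x 2 1)}"
    unfolding R by (auto simp: Id_on_def)
  with d show ?thesis by (simp add: eq_commute)
qed

lemma card_type_3C:
  assumes "type_3C R"
  shows "card R = 9"
proof -
  obtain x :: "nat \<Rightarrow> nat \<Rightarrow> 'a"
    where "inj_on (\<lambda>(i, j). x i j) ({0, 1, 2} \<times> {0, 1})"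
      and R: "R = Id_on ((\<lambda>(i, j). x i j) ` ({0, 1, 2} \<times> {0, 1})) \<union>
          {(x 0 0, x 0 1), (x 1 0, x 1 1), (x 2 0, x 2 1)}"
    using assms unfolding type_3C_def by auto
  then have d: "distinct [x 0 0, x 0 1, x 1 0, x 1 1, x 2 0, x 2 1]"
    by (simp add: inj_on_def eq_commute)
  have "R = {(x 0 0, x 0 0), (x 0 1, x 0 1), (x 1 0, x 1 0), (x 1 1, x 1 1), (x 2 0, x 2 0),
      (x 2 1, x 2 1), (x 0 0, x 0 1), (x 1 0, x 1 1), (x 2 0, x 2 1)}"
    unfolding R by (auto simp: Id_on_def)
  with d show ?thesis by (simp add: eq_commute)
qed

lemma card_type_33:
  assumes "type_33 R"
  shows "card R = 15"
proof -
  obtain A B where AB: "card A = 3" "card B = 3" "A \<inter> B = {}" and R: "R = Id_on (A \<union> B) \<union> A \<times> B"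
    using assms unfolding type_33_def by auto
  then have fin: "finite A" "finite B" by (metis card.infinite zero_neq_numeral)+
  have "Id_on (A \<union> B) = (\<lambda>x. (x, x)) ` (A \<union> B)" by (auto simp: Id_on_def)
  then have "card (Id_on (A \<union> B)) = 6"
    using AB fin by (simp add: card_image inj_on_def card_Un_disjoint)
  moreover have "card (A \<times> B) = 9" using AB by (simp add: card_cartesian_product)
  moreover have "Id_on (A \<union> B) \<inter> A \<times> B = {}" using AB(3) by auto
  ultimately show ?thesis
    unfolding R using fin by (subst card_Un_disjoint) (auto simp: Id_on_def)
qed

section \<open>Posets labelled by a tower\<close>

text \<open>
  The labelling \<open>e\<close> is part of the data since different labellings of one poset have to be compared:
  this is how automorphisms enter.
\<close>

locale labelled_tower =
  fixes P :: "'a rel" and n :: nat and t :: "nat \<Rightarrow> bool" and e :: "nat \<times> nat \<Rightarrow> 'a"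
  assumes labelling: "iso (tower n t) P e"
begin

lemma inj: "inj_on e (grid n)"
  and Field: "Field P = e ` grid n"
  and rel_iff: "p \<in> grid n \<Longrightarrow> q \<in> grid n \<Longrightarrow> (e p, e q) \<in> P \<longleftrightarrow> (p, q) \<in> tower n t"
  using labelling by (auto simp: iso_iff2 Field_tower bij_betw_def)

lemma eq_iff: "p \<in> grid n \<Longrightarrow> q \<in> grid n \<Longrightarrow> e p = e q \<longleftrightarrow> p = q"
  using inj by (rule inj_on_eq_iff)

lemma partial_order: "Partial_order P"
proof -
  have T: "\<And>p. p \<in> grid n \<Longrightarrow> (p, p) \<in> tower n t" "trans (tower n t)" "antisym (tower n t)"
    using tower_partial_order[of n t]
    by (auto simp: partial_order_on_def preorder_on_def refl_on_def Field_tower)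
  have "(x, z) \<in> P" if "(x, y) \<in> P" "(y, z) \<in> P" for x y z
  proof -
    have "x \<in> e ` grid n" "y \<in> e ` grid n" "z \<in> e ` grid n"
      unfolding Field[symmetric] using that by (auto simp: Field_def)
    then obtain p q r where pqr: "p \<in> grid n" "q \<in> grid n" "r \<in> grid n" "x = e p" "y = e q" "z = e r"
      by auto
    with that have "(p, q) \<in> tower n t" "(q, r) \<in> tower n t" by (auto simp: rel_iff)
    then have "(p, r) \<in> tower n t" by (rule transD[OF T(2)])
    with pqr show ?thesis by (simp add: rel_iff)
  qed
  moreover have "x = y" if "(x, y) \<in> P" "(y, x) \<in> P" for x y
  proof -
    have "x \<in> e ` grid n" "y \<in> e ` grid n"
      unfolding Field[symmetric] using that by (auto simp: Field_def)
    then obtain p q where pq: "p \<in> grid n" "q \<in> grid n" "x = e p" "y = e q" by auto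
    with that have "(p, q) \<in> tower n t" "(q, p) \<in> tower n t" by (auto simp: rel_iff)
    then have "p = q" by (rule antisymD[OF T(3)])
    with pq show ?thesis by simp
  qed
  moreover have "(x, x) \<in> P" if "x \<in> Field P" for x
    using that T(1) unfolding Field by (auto simp: rel_iff)
  moreover have "P \<subseteq> Field P \<times> Field P" by (auto simp: Field_def)
  ultimately show ?thesis
    unfolding partial_order_on_def preorder_on_def refl_on_def trans_def antisym_def by blast
qed

lemma refl: "x \<in> Field P \<Longrightarrow> (x, x) \<in> P"
  using partial_order by (auto simp: partial_order_on_def preorder_on_def refl_on_def)

lemma finite_Field: "finite (Field P)"
  unfolding Field grid_def by simp

abbreviation row :: "nat \<Rightarrow> 'a set"
  where "row k \<equiv> (\<lambda>i. e (k, i)) ` {0, 1, 2}"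

lemma row_le_iff:
  assumes "k \<le> n" "l \<le> n" "i \<in> {0, 1, 2}" "j \<in> {0, 1, 2}"
  shows "(e (k, i), e (l, j)) \<in> P \<longleftrightarrow>
    k = l \<and> i = j \<or> l = k + 1 \<and> (t k \<longleftrightarrow> i \<noteq> j) \<or> k + 2 \<le> l"
proof -
  have "(k, i) \<in> grid n" "(l, j) \<in> grid n" using assms by (auto simp: grid_def)
  with rel_iff show ?thesis using assms by (simp add: tower_iff del: insert_iff)
qed

lemma row_eq_iff:
  assumes "k \<le> n" "l \<le> n" "i \<in> {0, 1, 2}" "j \<in> {0, 1, 2}"
  shows "e (k, i) = e (l, j) \<longleftrightarrow> k = l \<and> i = j"
proof -
  have "(k, i) \<in> grid n" "(l, j) \<in> grid n" using assms by (auto simp: grid_def)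
  with eq_iff show ?thesis by simp
qed

lemma Field_rows: "Field P = (\<Union>k\<in>{..n}. row k)"
  unfolding Field grid_def by auto

lemma row_decomposition: "row_decomposition P n row"
proof
  fix k x y assume "k \<le> n" "x \<in> row k" "y \<in> row k" "(x, y) \<in> P"
  then show "x = y" by (elim imageE) (simp add: row_le_iff del: insert_iff)
next
  fix k l x y assume "k < l" "l \<le> n" "x \<in> row l" "y \<in> row k"
  then show "(x, y) \<notin> P" by (elim imageE) (simp add: row_le_iff del: insert_iff)
next
  fix k l y assume kl: "k < l" "l \<le> n" and "y \<in> row l"
  then obtain j where j: "j \<in> {0, 1, 2}" "y = e (l, j)" by blast
  have "\<exists>i \<in> {0, 1, 2}. t k \<longleftrightarrow> i \<noteq> j" by (cases "t k"; cases "j = 0") (use j in auto)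
  then obtain i where "i \<in> {0, 1, 2}" "t k \<longleftrightarrow> i \<noteq> j" ..
  with kl j have "(e (k, i), y) \<in> P" by (simp add: row_le_iff del: insert_iff) linarith
  with \<open>i \<in> {0, 1, 2}\<close> show "\<exists>x \<in> row k. (x, y) \<in> P" by blast
qed (fact refl Field_rows)+

lemmas level_eq_row = row_decomposition.level_eq[OF row_decomposition]
lemmas level_pair_eq = row_decomposition.level_pair_eq[OF row_decomposition]

lemma six_crown_level_pair:
  assumes "k < n" "t k"
  shows "six_crown (level_pair P k (k + 1))"
proof -
  \<comment> \<open>going around the crown, the upper point between \<open>i\<close> and \<open>i + 1\<close> is the partner of the third column\<close>
  define x where "x i j = e (k + j, if j = 0 then i else if i = 0 then 2 else i - 1)" for i j :: nat
  have x: "x 0 0 = e (k, 0)" "x 1 0 = e (k, 1)" "x 2 0 = e (k, 2)"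
    "x 0 1 = e (k + 1, 2)" "x 1 1 = e (k + 1, 0)" "x 2 1 = e (k + 1, 1)"
    by (simp_all add: x_def)
  have "inj_on (\<lambda>(i, j). x i j) ({0, 1, 2} \<times> {0, 1})"
    unfolding inj_on_def using assms x by (simp add: row_eq_iff)
  moreover have "level_pair P k (k + 1) = Id_on ((\<lambda>(i, j). x i j) ` ({0, 1, 2} \<times> {0, 1})) \<union>
          {(x 0 0, x 0 1), (x 1 0, x 0 1), (x 1 0, x 1 1),
           (x 2 0, x 1 1), (x 2 0, x 2 1), (x 0 0, x 2 1)}"
  proof -
    have "row k \<union> row (k + 1) = (\<lambda>(i, j). x i j) ` ({0, 1, 2} \<times> {0, 1})"
      using x by auto
    moreover have "P \<inter> row k \<times> row (k + 1) = {(x 0 0, x 0 1), (x 1 0, x 0 1), (x 1 0, x 1 1),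
           (x 2 0, x 1 1), (x 2 0, x 2 1), (x 0 0, x 2 1)}"
      unfolding x using assms by (auto simp: row_le_iff)
    ultimately show ?thesis using level_pair_eq[of k "k + 1"] assms by simp
  qed
  ultimately show ?thesis unfolding six_crown_def by blast
qed

lemma type_3C_level_pair:
  assumes "k < n" "\<not> t k"
  shows "type_3C (level_pair P k (k + 1))"
proof -
  define x where "x i j = e (k + j, i)" for i j :: nat
  have x: "x i 0 = e (k, i)" "x i 1 = e (k + 1, i)" for i
    by (simp_all add: x_def)
  have "inj_on (\<lambda>(i, j). x i j) ({0, 1, 2} \<times> {0, 1})"
    unfolding inj_on_def using assms x by (simp add: row_eq_iff)
  moreover have "level_pair P k (k + 1) = Id_on ((\<lambda>(i, j). x i j) ` ({0, 1, 2} \<times> {0, 1})) \<union>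
          {(x 0 0, x 0 1), (x 1 0, x 1 1), (x 2 0, x 2 1)}"
  proof -
    have "row k \<union> row (k + 1) = (\<lambda>(i, j). x i j) ` ({0, 1, 2} \<times> {0, 1})"
      using x by auto
    moreover have "P \<inter> row k \<times> row (k + 1) = {(x 0 0, x 0 1), (x 1 0, x 1 1), (x 2 0, x 2 1)}"
      unfolding x using assms by (auto simp: row_le_iff)
    ultimately show ?thesis using level_pair_eq[of k "k + 1"] assms by simp
  qed
  ultimately show ?thesis unfolding type_3C_def by blast
qed

lemma card_level_pair:
  "k < n \<Longrightarrow> card (level_pair P k (k + 1)) = (if t k then 12 else 9)"
  using six_crown_level_pair[of k] type_3C_level_pair[of k]
  by (auto dest: card_six_crown card_type_3C)

lemma type_33_level_pair:
  assumes "k + 2 \<le> n"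
  shows "type_33 (level_pair P k (k + 2))"
proof -
  have "card (row m) = 3" if "m \<le> n" for m
    using that by (simp add: row_eq_iff)
  moreover have "row k \<inter> row (k + 2) = {}" using assms by (auto simp: row_eq_iff)
  moreover have "P \<inter> row k \<times> row (k + 2) = row k \<times> row (k + 2)"
    using assms by (auto simp: row_le_iff)
  ultimately show ?thesis
    unfolding type_33_def using level_pair_eq[of k "k + 2"] assms
    by (intro exI[of _ "row k"] exI[of _ "row (k + 2)"]) (simp del: image_insert)
qed

text \<open>
  Along a fixed column of a tower the order breaks off at each crown, where a point is not below its
  own partner.  Moving on by one column at each crown repairs this and produces the three chains that
  the definition of a section asks for; \<open>twist k\<close> counts the moves made below row \<open>k\<close>.
\<close>

definition twist :: "nat \<Rightarrow> nat"
  where "twist k = card {m. m < k \<and> t m}"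

lemma twist_Suc: "twist (Suc k) = twist k + of_bool (t k)"
proof -
  have "{m. m < Suc k \<and> t m} = (if t k then insert k else id) {m. m < k \<and> t m}"
    by (auto simp: less_Suc_eq)
  then show ?thesis by (simp add: twist_def)
qed

definition strand :: "nat \<Rightarrow> nat \<Rightarrow> 'a"
  where "strand k j = e (k, (j + twist k) mod 3)"

lemma mod3_mem: "m mod 3 \<in> {0, 1, 2 :: nat}"
  by auto

lemma strand_le_iff:
  assumes "k \<le> n" "l \<le> n"
  shows "(strand k i, strand l j) \<in> P \<longleftrightarrow>
    k = l \<and> (i + twist k) mod 3 = (j + twist l) mod 3 \<or>
    l = k + 1 \<and> (t k \<longleftrightarrow> (i + twist k) mod 3 \<noteq> (j + twist l) mod 3) \<or> k + 2 \<le> l"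
  unfolding strand_def by (rule row_le_iff[OF assms mod3_mem mod3_mem])

lemma strand_chain:
  assumes "k < l" "l \<le> n"
  shows "(strand k j, strand l j) \<in> P"
proof -
  have "t k \<longleftrightarrow> (j + twist k) mod 3 \<noteq> (j + twist (Suc k)) mod 3"
    unfolding twist_Suc by (cases "t k") (simp_all, presburger)
  with assms show ?thesis by (cases "l = Suc k") (simp_all add: strand_le_iff)
qed

text \<open>
  In each row the strands are the columns shifted by a constant.
\<close>

lemma bij_betw_strand: "bij_betw (\<lambda>(k, j). strand k j) ({0..n} \<times> {0, 1, 2}) (Field P)"
proof -
  let ?r = "\<lambda>(k :: nat, j :: nat). (k, (j + twist k) mod 3)"
  have "bij_betw ?r (grid n) (grid n)" by (rule bij_betw_grid[OF bij_betw_rotate3])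
  moreover have "bij_betw e (grid n) (Field P)" using inj Field by (simp add: bij_betw_def)
  ultimately have "bij_betw (e \<circ> ?r) (grid n) (Field P)" by (rule bij_betw_trans)
  moreover have "e \<circ> ?r = (\<lambda>(k, j). strand k j)" by (auto simp: strand_def)
  ultimately show ?thesis by (simp add: grid_def)
qed

lemma height: "height P = n"
proof -
  have bound: "finite C \<and> card C \<le> n + 1" if "C \<in> Chains P" for C
  proof -
    define D where "D = {p \<in> grid n. e p \<in> C}"
    have "(x, x) \<in> P" if "x \<in> C" for x using \<open>C \<in> Chains P\<close> that by (auto simp: Chains_def)
    then have "C \<subseteq> Field P" by (meson FieldI1 subsetI)
    then have C: "C = e ` D" unfolding D_def Field by auto
    have "finite D" by (simp add: D_def grid_def)
    have "inj_on fst D"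
    proof (rule inj_onI, clarsimp)
      fix k i j assume "(k, i) \<in> D" "(k, j) \<in> D"
      then have "(k, i) \<in> grid n" "(k, j) \<in> grid n"
        and "(e (k, i), e (k, j)) \<in> P \<or> (e (k, j), e (k, i)) \<in> P"
        using that by (auto simp: D_def Chains_def)
      then show "i = j" by (auto simp: rel_iff tower_def)
    qed
    moreover have "fst ` D \<subseteq> {0..n}" by (auto simp: D_def grid_def)
    ultimately have "card D \<le> card {0..n}" by (intro card_inj_on_le) simp_all
    moreover have "card C \<le> card D" unfolding C by (rule card_image_le[OF \<open>finite D\<close>])
    ultimately show ?thesis using C \<open>finite D\<close> by simp
  qed
  let ?C = "(\<lambda>k. strand k 0) ` {0..n}"
  have "(strand k 0, strand l 0) \<in> P \<or> (strand l 0, strand k 0) \<in> P" if "k \<le> n" "l \<le> n" for k l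
  proof (cases "k = l")
    case True
    have "strand k 0 \<in> Field P" using that bij_betw_apply[OF bij_betw_strand, of "(k, 0)"] by simp
    with True show ?thesis using refl by simp
  qed (use that strand_chain[of k l 0] strand_chain[of l k 0] in linarith)
  then have "?C \<in> Chains P" by (auto simp: Chains_def)
  moreover have "card ?C = n + 1"
  proof -
    have "inj_on (\<lambda>k. strand k 0) {0..n}"
    proof (rule inj_onI)
      fix k l assume kl: "k \<in> {0..n}" "l \<in> {0..n}" and eq: "strand k 0 = strand l 0"
      then have "k \<le> n" "l \<le> n" by auto
      with eq show "k = l" unfolding strand_def using row_eq_iff[OF _ _ mod3_mem mod3_mem] by blast
    qed
    then show ?thesis by (simp add: card_image)
  qed
  moreover have "finite (card ` Chains P)"
    by (rule finite_subset[of _ "{..n + 1}"]) (use bound in auto)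
  ultimately have "Max (card ` Chains P) = n + 1"
    by (intro Max_eqI) (use bound in force)+
  then show ?thesis by (simp add: height_def)
qed

lemma extend_row_permutation:
  assumes "bij_betw \<rho> {0, 1, 2} {0, 1, 2}"
  obtains f where "iso P P f" "\<And>k i. (k, i) \<in> grid n \<Longrightarrow> f (e (k, i)) = e (k, \<rho> i)"
proof
  let ?f = "e \<circ> ((\<lambda>(k, i). (k, \<rho> i)) \<circ> inv_into (grid n) e)"
  have "iso P (tower n t) (inv_into (grid n) e)"
    using iso_inverse[OF labelling] by (simp add: Field_tower)
  then show "iso P P ?f"
    by (intro comp_iso[OF comp_iso[OF _ tower_permute[OF assms]] labelling])
  show "?f (e (k, i)) = e (k, \<rho> i)" if "(k, i) \<in> grid n" for k i
    using that inj by simp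
qed

lemma width3_section:
  assumes "n \<ge> 1"
  shows "width3_section P"
proof -
  obtain f where f: "iso P P f" "\<And>k i. (k, i) \<in> grid n \<Longrightarrow> f (e (k, i)) = e (k, (i + 1) mod 3)"
    using extend_row_permutation[OF bij_betw_rotate3[of 1]] by blast
  have rotate: "f (strand k j) = strand k ((j + 1) mod 3)" if "k \<le> n" for k j
  proof -
    have "(k, (j + twist k) mod 3) \<in> grid n"
      using that mod3_mem unfolding grid_def by simp
    then show ?thesis by (simp add: strand_def f(2) mod_simps add_ac)
  qed
  have "\<not> type_33 (level_pair P k (k + 1))" if "k < n" for k
    using card_level_pair[OF that] card_type_33[of "level_pair P k (k + 1)"] by (auto split: if_splits)
  moreover have "i = j" if "k \<le> n" "i \<in> {0, 1, 2}" "j \<in> {0, 1, 2}" "(strand k i, strand k j) \<in> P" for k i j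
  proof -
    have "(i + twist k) mod 3 = (j + twist k) mod 3"
      using that(1,4) by (simp add: strand_le_iff)
    then show ?thesis
      using that(2,3) by (rule inj_onD[OF bij_betw_imp_inj_on[OF bij_betw_rotate3]])
  qed
  moreover have "(strand k j, strand (k + 1) j) \<in> P" if "k < n" for k j
    using strand_chain[of k "k + 1" j] that by simp
  ultimately show ?thesis
    unfolding width3_section_def height
    using assms partial_order finite_Field bij_betw_strand f(1) rotate
    by (intro conjI exI[of _ strand] exI[of _ f]) (auto simp: bij_betw_def simp del: insert_iff)
qed

lemma irreducible_point_iff:
  "n \<ge> 1 \<Longrightarrow> (\<exists>x. irreducible_point P x) \<longleftrightarrow> \<not> t 0 \<or> \<not> t (n - 1)"
  using iso_irreducible_point[OF labelling] tower_irreducible_point by simp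

lemma horizon:
  assumes "n \<ge> 2"
  shows "horizon P = 2"
  unfolding horizon_def height
proof (rule Least_equality)
  show "2 \<ge> (1 :: nat) \<and> (\<forall>k. k + 2 \<le> n \<longrightarrow> type_33 (level_pair P k (k + 2)))"
    using type_33_level_pair by simp
next
  fix \<eta> :: nat assume \<eta>: "\<eta> \<ge> 1 \<and> (\<forall>k. k + \<eta> \<le> n \<longrightarrow> type_33 (level_pair P k (k + \<eta>)))"
  have "\<not> type_33 (level_pair P 0 1)"
    using card_level_pair[of 0] card_type_33[of "level_pair P 0 1"] assms by (auto split: if_splits)
  with \<eta> assms have "\<eta> \<noteq> 1" by (metis add_0 le_trans one_le_numeral)
  with \<eta> show "2 \<le> \<eta>" by linarith
qed

text \<open>
  Crowns at the bottom and at the top exclude irreducible points.  The horizon is two because the pairs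
  at distance two are complete while the bottom pair is not.
\<close>

lemma in_N2: "n \<ge> 2 \<Longrightarrow> t 0 \<Longrightarrow> t (n - 1) \<Longrightarrow> P \<in> N2"
  using width3_section irreducible_point_iff horizon height
  by (auto simp: N2_def nice_section_def)

end

text \<open>
  A point of row \<open>k + 1\<close> is recognised by its relation to row \<open>k\<close>: its partner is the only point of
  that row that it fails to dominate in a crown, and the only one that it dominates in a pair of type
  \<open>3C\<close>.  A labelling is therefore propagated from the bottom row to all rows.
\<close>

lemma labelling_unique:
  assumes "iso (tower n t) P e" "iso (tower n t) P e'"
    and base: "\<And>i. i \<in> {0, 1, 2} \<Longrightarrow> e (0, i) = e' (0, i)"
    and "(k, i) \<in> grid n"
  shows "e (k, i) = e' (k, i)"
proof -
  interpret e: labelled_tower P n t e by (rule labelled_tower.intro[OF assms(1)])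
  interpret e': labelled_tower P n t e' by (rule labelled_tower.intro[OF assms(2)])
  have "\<forall>i \<in> {0, 1, 2}. e (k, i) = e' (k, i)" if "k \<le> n" for k
    using that
  proof (induction k)
    case (Suc k)
    show ?case
    proof
      fix j :: nat assume j: "j \<in> {0, 1, 2}"
      have "e (Suc k, j) \<in> e'.row (Suc k)"
        using e.level_eq_row[OF Suc.prems] e'.level_eq_row[OF Suc.prems] j by blast
      then obtain j' where j': "j' \<in> {0, 1, 2}" "e (Suc k, j) = e' (Suc k, j')" by blast
      have "(e (k, j), e (Suc k, j)) \<in> P \<longleftrightarrow> (e' (k, j), e' (Suc k, j')) \<in> P"
      proof -
        have "e (k, j) = e' (k, j)" using Suc.IH Suc.prems j by (meson Suc_leD)
        with j'(2) show ?thesis by simp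
      qed
      moreover have "(e (k, j), e (Suc k, j)) \<in> P \<longleftrightarrow> \<not> t k"
        using Suc.prems j by (simp add: e.row_le_iff del: insert_iff)
      moreover have "(e' (k, j), e' (Suc k, j')) \<in> P \<longleftrightarrow> (t k \<longleftrightarrow> j \<noteq> j')"
        using Suc.prems j j' by (simp add: e'.row_le_iff del: insert_iff)
      ultimately have "j' = j" by blast
      with j' show "e (Suc k, j) = e' (Suc k, j)" by simp
    qed
  qed (use base in blast)
  then show ?thesis using assms(4) by (auto simp: grid_def)
qed

section \<open>Labelling a section by a tower\<close>

text \<open>
  The data that the definition of a section of width three provides, with the rotation \<open>f\<close> and the
  labels \<open>c\<close> fixed.
\<close>

locale section_labelling =
  fixes P :: "'a rel" and n :: nat and c :: "nat \<Rightarrow> nat \<Rightarrow> 'a" and f :: "'a \<Rightarrow> 'a"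
  assumes partial_order: "Partial_order P"
    and inj: "inj_on (\<lambda>(k, j). c k j) ({0..n} \<times> {0, 1, 2})"
    and Field: "Field P = (\<lambda>(k, j). c k j) ` ({0..n} \<times> {0, 1, 2})"
    and strand_steps: "\<forall>j \<in> {0, 1, 2}. \<forall>k < n. (c k j, c (k + 1) j) \<in> P"
    and antichains: "\<forall>k \<in> {0..n}. \<forall>i \<in> {0, 1, 2}. \<forall>j \<in> {0, 1, 2}. (c k i, c k j) \<in> P \<longrightarrow> i = j"
    and automorphism: "iso P P f"
    and rotations: "\<forall>k \<in> {0..n}. \<forall>j \<in> {0, 1, 2}. f (c k j) = c k ((j + 1) mod 3)"
begin

lemma strand_step: "j \<in> {0, 1, 2} \<Longrightarrow> k < n \<Longrightarrow> (c k j, c (Suc k) j) \<in> P"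
  using strand_steps[THEN bspec, of j] by simp

lemma antichain:
  "k \<le> n \<Longrightarrow> i \<in> {0, 1, 2} \<Longrightarrow> j \<in> {0, 1, 2} \<Longrightarrow> (c k i, c k j) \<in> P \<Longrightarrow> i = j"
  using antichains[THEN bspec, THEN bspec, THEN bspec, of k i j] by (simp del: insert_iff)

lemma in_Field: "k \<le> n \<Longrightarrow> j \<in> {0, 1, 2} \<Longrightarrow> c k j \<in> Field P"
  unfolding Field by force

lemma refl: "x \<in> Field P \<Longrightarrow> (x, x) \<in> P"
  using partial_order by (auto simp: partial_order_on_def preorder_on_def refl_on_def)

lemma trans: "(x, y) \<in> P \<Longrightarrow> (y, z) \<in> P \<Longrightarrow> (x, z) \<in> P"
  using partial_order unfolding partial_order_on_def preorder_on_def by (blast dest: transD)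

lemma antisym: "(x, y) \<in> P \<Longrightarrow> (y, x) \<in> P \<Longrightarrow> x = y"
  using partial_order unfolding partial_order_on_def by (blast dest: antisymD)

lemma eq_iff:
  assumes "k \<le> n" "l \<le> n" "i \<in> {0, 1, 2}" "j \<in> {0, 1, 2}"
  shows "c k i = c l j \<longleftrightarrow> k = l \<and> i = j"
  using inj_on_eq_iff[OF inj, of "(k, i)" "(l, j)"] assms by (simp del: insert_iff)

lemma strand_le:
  assumes "k \<le> l" "l \<le> n" "j \<in> {0, 1, 2}"
  shows "(c k j, c l j) \<in> P"
  using assms(1,2)
proof (induction rule: dec_induct)
  case base
  then show ?case using refl in_Field assms(3) by simp
next
  case (step m)
  then have "(c k j, c m j) \<in> P" "(c m j, c (Suc m) j) \<in> P" using strand_step assms(3) by auto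
  then show ?case by (rule trans)
qed

text \<open>
  A relation downwards, composed with the strand through its upper point, would be a relation inside
  an antichain, unless it returned to its start against antisymmetry.
\<close>

lemma not_down:
  assumes "k < l" "l \<le> n" "i \<in> {0, 1, 2}" "j \<in> {0, 1, 2}"
  shows "(c l i, c k j) \<notin> P"
proof
  assume down: "(c l i, c k j) \<in> P"
  have up: "(c k i, c l i) \<in> P" using assms strand_le by simp
  then have "(c k i, c k j) \<in> P" using down by (rule trans)
  then have "i = j" using antichain[of k i j] assms by simp
  with up down have "c k i = c l i" by (simp add: antisym)
  then show False using eq_iff[of k l i i] assms by simp
qed

abbreviation row :: "nat \<Rightarrow> 'a set"
  where "row k \<equiv> c k ` {0, 1, 2}"

lemma card_row: "k \<le> n \<Longrightarrow> card (row k) = 3"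
  using eq_iff[of k k] by simp

lemma row_disjoint: "k < l \<Longrightarrow> l \<le> n \<Longrightarrow> row k \<inter> row l = {}"
  using eq_iff[of k l] by auto

lemma row_antichain:
  assumes "k \<le> n" "x \<in> row k" "y \<in> row k" "(x, y) \<in> P"
  shows "x = y"
proof -
  obtain i where i: "i \<in> {0, 1, 2}" "x = c k i" using assms(2) by (rule imageE)
  obtain j where j: "j \<in> {0, 1, 2}" "y = c k j" using assms(3) by (rule imageE)
  have "i = j" using antichain[OF assms(1) i(1) j(1)] assms(4) i(2) j(2) by simp
  with i j show ?thesis by simp
qed

lemma row_not_down:
  assumes "k < l" "l \<le> n" "x \<in> row l" "y \<in> row k"
  shows "(x, y) \<notin> P"
proof -
  obtain i where i: "i \<in> {0, 1, 2}" "x = c l i" using assms(3) by (rule imageE)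
  obtain j where j: "j \<in> {0, 1, 2}" "y = c k j" using assms(4) by (rule imageE)
  show ?thesis unfolding i(2) j(2) by (rule not_down[OF assms(1,2) i(1) j(1)])
qed

lemma row_decomposition: "row_decomposition P n row"
proof
  show "Field P = (\<Union>k\<in>{..n}. row k)" unfolding Field by auto
next
  fix k l y assume kl: "k < l" "l \<le> n" and "y \<in> row l"
  then obtain j where j: "j \<in> {0, 1, 2}" "y = c l j" by (elim imageE)
  have "(c k j, y) \<in> P" unfolding j(2) by (rule strand_le[OF _ kl(2) j(1)]) (use kl in simp)
  then show "\<exists>x \<in> row k. (x, y) \<in> P" using imageI[OF j(1)] by (rule bexI)
qed (fact refl row_antichain row_not_down)+

lemmas level_pair_eq = row_decomposition.level_pair_eq[OF row_decomposition]

text \<open>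
  Identifying the two antichains of a pair of type \<open>33\<close> with the rows is avoided by counting: of the
  15 elements of the relation 6 are reflexive pairs, so all nine pairs between the rows occur.
\<close>

lemma type_33_iff:
  assumes "k < l" "l \<le> n"
  shows "type_33 (level_pair P k l) \<longleftrightarrow> row k \<times> row l \<subseteq> P"
proof
  have rows: "card (row k) = 3" "card (row l) = 3" "row k \<inter> row l = {}"
    using assms card_row row_disjoint by (simp_all del: image_insert)
  show "type_33 (level_pair P k l)" if "row k \<times> row l \<subseteq> P"
    unfolding type_33_def level_pair_eq[OF assms] using rows that
    by (intro exI[of _ "row k"] exI[of _ "row l"]) (simp add: Int_absorb1 del: image_insert)
  assume "type_33 (level_pair P k l)"
  then have "card (level_pair P k l) = 15" by (rule card_type_33)
  moreover have "card (level_pair P k l) \<le> card (Id_on (row k \<union> row l)) + card (P \<inter> row k \<times> row l)"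
    unfolding level_pair_eq[OF assms] by (rule card_Un_le)
  moreover have "card (Id_on (row k \<union> row l)) \<le> 6"
  proof -
    have "Id_on (row k \<union> row l) = (\<lambda>x. (x, x)) ` (row k \<union> row l)" by (auto simp: Id_on_def)
    also have "card \<dots> \<le> card (row k \<union> row l)" by (rule card_image_le) simp
    also have "\<dots> \<le> card (row k) + card (row l)" by (rule card_Un_le)
    finally show ?thesis unfolding rows by simp
  qed
  ultimately have "9 \<le> card (P \<inter> row k \<times> row l)" by linarith
  then have "card (row k \<times> row l) \<le> card (P \<inter> row k \<times> row l)"
    unfolding card_cartesian_product rows by simp
  then have "P \<inter> row k \<times> row l = row k \<times> row l" by (intro card_seteq) auto
  then show "row k \<times> row l \<subseteq> P" by blast
qed

lemma rotate:
  assumes "k \<le> n" "l \<le> n" "i \<in> {0, 1, 2}" "j \<in> {0, 1, 2}"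
  shows "(c k i, c l j) \<in> P \<longleftrightarrow> (c k ((i + 1) mod 3), c l ((j + 1) mod 3)) \<in> P"
proof -
  have "(c k i, c l j) \<in> P \<longleftrightarrow> (f (c k i), f (c l j)) \<in> P"
    using automorphism in_Field assms unfolding iso_iff2 by (simp del: insert_iff)
  moreover have "f (c k i) = c k ((i + 1) mod 3)" "f (c l j) = c l ((j + 1) mod 3)"
    using rotations[THEN bspec, THEN bspec] assms by (simp_all del: insert_iff)
  ultimately show ?thesis by simp
qed

text \<open>
  By rotation, the relation between consecutive rows is determined by the set of \<open>d\<close> with
  \<open>c k 0\<close> below \<open>c (k + 1) d\<close>.  This set contains \<open>0\<close> because of the strands, and it is not everything.
  If it is \<open>{0}\<close>, the strands are the matching; otherwise one residue is missing, and the matching pairs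
  each point with the point of the next row shifted by that residue.
\<close>

lemma consecutive_rows:
  assumes "k < n" "\<not> type_33 (level_pair P k (k + 1))"
  shows "\<exists>t \<pi>. bij_betw \<pi> {0, 1, 2} {0, 1, 2} \<and>
    (\<forall>i \<in> {0, 1, 2}. \<forall>j \<in> {0, 1, 2}. (c k i, c (Suc k) (\<pi> j)) \<in> P \<longleftrightarrow> (t \<longleftrightarrow> i \<noteq> j))"
proof -
  define r where "r d \<longleftrightarrow> (c k 0, c (Suc k) d) \<in> P" for d
  have "r 0" using strand_step[of 0 k] assms by (simp add: r_def)
  have rot: "(c k i, c (Suc k) j) \<in> P \<longleftrightarrow> (c k ((i + 1) mod 3), c (Suc k) ((j + 1) mod 3)) \<in> P"
    if "i \<in> {0, 1, 2}" "j \<in> {0, 1, 2}" for i j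
    using rotate[of k "Suc k" i j] assms that by (simp del: insert_iff)
  have rel: "(c k 0, c (Suc k) d) \<in> P \<longleftrightarrow> r d" for d by (simp add: r_def)
  have rels: "(c k (Suc 0), c (Suc k) 0) \<in> P \<longleftrightarrow> r 2" "(c k (Suc 0), c (Suc k) (Suc 0)) \<in> P \<longleftrightarrow> r 0"
    "(c k (Suc 0), c (Suc k) 2) \<in> P \<longleftrightarrow> r 1" "(c k 2, c (Suc k) 0) \<in> P \<longleftrightarrow> r 1"
    "(c k 2, c (Suc k) (Suc 0)) \<in> P \<longleftrightarrow> r 2" "(c k 2, c (Suc k) 2) \<in> P \<longleftrightarrow> r 0"
    using rot[of 0 0] rot[of 0 1] rot[of 0 2] rot[of 1 0] rot[of 1 1] rot[of 1 2]
    by (simp_all add: rel numeral_2_eq_2[symmetric])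
  have "\<not> (r 1 \<and> r 2)"
  proof
    assume "r 1 \<and> r 2"
    then have "\<forall>i \<in> {0, 1, 2}. \<forall>j \<in> {0, 1, 2}. (c k i, c (Suc k) j) \<in> P"
      using \<open>r 0\<close> by (simp add: rel rels)
    then have "row k \<times> row (Suc k) \<subseteq> P" by (auto simp del: insert_iff image_insert)
    then show False using type_33_iff[of k "Suc k"] assms by (simp del: image_insert)
  qed
  then consider "\<not> r 1" "\<not> r 2" | "r 1" "\<not> r 2" | "\<not> r 1" "r 2" by blast
  then show ?thesis
  proof cases
    case 1
    with \<open>r 0\<close> show ?thesis
      by (intro exI[of _ False] exI[of _ "\<lambda>j. (j + 0) mod 3"] conjI bij_betw_rotate3)
        (simp add: rel rels numeral_2_eq_2[symmetric])
  next
    case 2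
    with \<open>r 0\<close> show ?thesis
      by (intro exI[of _ True] exI[of _ "\<lambda>j. (j + 2) mod 3"] conjI bij_betw_rotate3)
        (simp add: rel rels numeral_2_eq_2[symmetric])
  next
    case 3
    with \<open>r 0\<close> show ?thesis
      by (intro exI[of _ True] exI[of _ "\<lambda>j. (j + 1) mod 3"] conjI bij_betw_rotate3)
        (simp add: rel rels numeral_2_eq_2[symmetric])
  qed
qed

text \<open>
  The matchings \<open>\<pi> k\<close> between consecutive rows are composed from the bottom upwards.  Relabelling row
  \<open>k\<close> by the composition \<open>p k\<close> of the first \<open>k\<close> of them turns every matching into the identity, and
  the pairs at distance at least two are complete, so that a tower results.
\<close>

lemma tower_labelling:
  assumes step: "\<And>k. k < n \<Longrightarrow> \<not> type_33 (level_pair P k (k + 1))"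
    and full: "\<And>k. k + 2 \<le> n \<Longrightarrow> type_33 (level_pair P k (k + 2))"
  obtains t e where "iso (tower n t) P e"
proof -
  have "\<forall>k. \<exists>t \<pi>. k < n \<longrightarrow> bij_betw \<pi> {0, 1, 2} {0, 1, 2} \<and>
    (\<forall>i \<in> {0, 1, 2}. \<forall>j \<in> {0, 1, 2}. (c k i, c (Suc k) (\<pi> j)) \<in> P \<longleftrightarrow> (t \<longleftrightarrow> i \<noteq> j))"
    (is "\<forall>k. \<exists>t \<pi>. k < n \<longrightarrow> ?Q k t \<pi>")
  proof
    fix k show "\<exists>t \<pi>. k < n \<longrightarrow> ?Q k t \<pi>"
      using consecutive_rows[of k] step[of k] by (cases "k < n") (simp_all only: simp_thms)
  qed
  then obtain t \<pi> where t\<pi>: "\<forall>k. k < n \<longrightarrow> ?Q k (t k) (\<pi> k)"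
    unfolding choice_iff by (elim exE)
  have \<pi>: "bij_betw (\<pi> k) {0, 1, 2} {0, 1, 2}" if "k < n" for k
    using t\<pi> that by blast
  have t: "(c k i, c (Suc k) (\<pi> k j)) \<in> P \<longleftrightarrow> (t k \<longleftrightarrow> i \<noteq> j)"
    if "k < n" "i \<in> {0, 1, 2}" "j \<in> {0, 1, 2}" for k i j
    by (rule bspec[OF bspec[OF conjunct2[OF mp[OF spec[OF t\<pi>] that(1)]] that(2)] that(3)])
  define p where "p = rec_nat id (\<lambda>k q. \<pi> k \<circ> q)"
  have p: "p 0 = id" "p (Suc k) = \<pi> k \<circ> p k" for k by (simp_all add: p_def)
  have bij: "bij_betw (p k) {0, 1, 2} {0, 1, 2}" if "k \<le> n" for k
    using that
  proof (induction k)
    case (Suc k)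
    then show ?case unfolding p by (intro bij_betw_trans[OF _ \<pi>]) simp_all
  qed (simp only: p bij_betw_id)
  have p_mem: "p k i \<in> {0, 1, 2}" if "k \<le> n" "i \<in> {0, 1, 2}" for k i
    by (rule bij_betw_apply[OF bij[OF that(1)] that(2)])
  have p_eq: "p k i = p k j \<longleftrightarrow> i = j" if "k \<le> n" "i \<in> {0, 1, 2}" "j \<in> {0, 1, 2}" for k i j
    by (rule inj_on_eq_iff[OF bij_betw_imp_inj_on[OF bij[OF that(1)]] that(2,3)])
  have far: "(c k i, c l j) \<in> P"
    if "k + 2 \<le> l" "l \<le> n" "i \<in> {0, 1, 2}" "j \<in> {0, 1, 2}" for k l i j
  proof -
    have "row k \<times> row (k + 2) \<subseteq> P"
      by (rule iffD1[OF type_33_iff full]) (use that in simp_all)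
    then have "(c k i, c (k + 2) j) \<in> P"
      using imageI[OF that(3), of "c k"] imageI[OF that(4), of "c (k + 2)"] by (meson SigmaI subsetD)
    moreover have "(c (k + 2) j, c l j) \<in> P" by (rule strand_le[OF that(1,2,4)])
    ultimately show ?thesis by (rule trans)
  qed
  let ?e = "(\<lambda>(k, i). c k i) \<circ> (\<lambda>(k, i). (k, p k i))"
  have "bij_betw ?e (grid n) (Field P)"
  proof (rule bij_betw_trans[OF bij_betw_grid[OF bij]])
    show "bij_betw (\<lambda>(k, i). c k i) (grid n) (Field P)"
      unfolding bij_betw_def grid_def using inj Field by simp
  qed
  moreover have "((k, i), (l, j)) \<in> tower n t \<longleftrightarrow> (c k (p k i), c l (p l j)) \<in> P"
    if "(k, i) \<in> grid n" "(l, j) \<in> grid n" for k i l j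
  proof -
    have kl: "k \<le> n" "l \<le> n" "i \<in> {0, 1, 2}" "j \<in> {0, 1, 2}" using that by (auto simp: grid_def)
    note mem = p_mem[OF kl(1,3)] p_mem[OF kl(2,4)]
    consider "k = l" | "l = Suc k" | "k + 2 \<le> l" | "l < k" by linarith
    then show ?thesis
    proof cases
      case 1
      have "(c k (p k i), c k (p k j)) \<in> P \<longleftrightarrow> i = j"
        using antichain[OF kl(1) mem(1), of "p k j"] mem(2) p_eq[OF kl(1,3,4)] refl in_Field[OF kl(1) mem(1)] 1
        by metis
      with 1 that show ?thesis by (auto simp: tower_def)
    next
      case 2
      then have k: "k < n" using kl by simp
      have "(c k (p k i), c l (p l j)) \<in> P \<longleftrightarrow> (t k \<longleftrightarrow> p k i \<noteq> p k j)"
        unfolding 2 p comp_def using t[OF k mem(1) p_mem[OF kl(1,4)]] .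
      also have "\<dots> \<longleftrightarrow> (t k \<longleftrightarrow> i \<noteq> j)" using p_eq[OF kl(1,3,4)] by simp
      finally show ?thesis using 2 that by (simp add: tower_def)
    next
      case 3
      with far[OF 3 kl(2) mem] that show ?thesis by (simp add: tower_def)
    next
      case 4
      with not_down[OF 4 kl(1) mem] that show ?thesis by (simp add: tower_def)
    qed
  qed
  ultimately have "iso (tower n t) P ?e" unfolding iso_iff2 Field_tower by auto
  then show ?thesis by (rule that)
qed

end

text \<open>
  The least number defining the horizon exists because every number exceeding the height satisfies
  the condition vacuously; hence the condition holds for \<open>2\<close>, the horizon.
\<close>

lemma N2_labelling:
  assumes "P \<in> N2"
  obtains t e where "iso (tower (height P) t) P e" "t 0" "t (height P - 1)"
proof -
  let ?n = "height P"
  have n: "?n \<ge> 2" and "horizon P = 2" and w: "width3_section P"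
    and nice: "\<not> irreducible_point P x" for x
    using assms by (auto simp: N2_def nice_section_def)
  have full: "type_33 (level_pair P k (k + 2))" if "k + 2 \<le> ?n" for k
  proof -
    let ?H = "\<lambda>\<eta>. \<eta> \<ge> 1 \<and> (\<forall>k. k + \<eta> \<le> ?n \<longrightarrow> type_33 (level_pair P k (k + \<eta>)))"
    have "?H (Suc ?n)" by simp
    then have "?H (horizon P)" unfolding horizon_def by (rule LeastI)
    with \<open>horizon P = 2\<close> that show ?thesis by simp
  qed
  obtain c :: "nat \<Rightarrow> nat \<Rightarrow> 'a" and f where "Partial_order P"
    "inj_on (\<lambda>(k, j). c k j) ({0..?n} \<times> {0, 1, 2})"
    "Field P = (\<lambda>(k, j). c k j) ` ({0..?n} \<times> {0, 1, 2})"
    "\<forall>j \<in> {0, 1, 2}. \<forall>k < ?n. (c k j, c (k + 1) j) \<in> P"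
    "\<forall>k \<in> {0..?n}. \<forall>i \<in> {0, 1, 2}. \<forall>j \<in> {0, 1, 2}. (c k i, c k j) \<in> P \<longrightarrow> i = j"
    "iso P P f" "\<forall>k \<in> {0..?n}. \<forall>j \<in> {0, 1, 2}. f (c k j) = c k ((j + 1) mod 3)"
    using w unfolding width3_section_def by (elim conjE exE) (rule that)
  then interpret labelled: section_labelling P ?n c f
    by (rule section_labelling.intro)
  obtain t e where te: "iso (tower ?n t) P e"
    by (rule labelled.tower_labelling[OF _ full]) (use w in \<open>simp_all add: width3_section_def\<close>)
  interpret labelled_tower P ?n t e by (rule labelled_tower.intro[OF te])
  have "t 0 \<and> t (?n - 1)" using irreducible_point_iff n nice by auto
  with te that show ?thesis by blast
qed

lemma N2_level_pair:
  assumes "P \<in> N2" "k < height P"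
  shows "six_crown (level_pair P k (k + 1)) \<or> type_3C (level_pair P k (k + 1))"
proof -
  from assms(1) obtain t e where "iso (tower (height P) t) P e" by (rule N2_labelling)
  then interpret labelled_tower P "height P" t e by (rule labelled_tower.intro)
  show ?thesis using six_crown_level_pair type_3C_level_pair assms(2) by blast
qed

text \<open>
  The special case of equal posets shows that a poset determines the types in all its labellings.
\<close>

lemma tower_type_determined:
  assumes "iso (tower n t) P e" "iso (tower n t') Q e'"
    and "level_pair P k (k + 1) \<simeq> level_pair Q k (k + 1)" "k < n"
  shows "t k \<longleftrightarrow> t' k"
proof -
  have "card (level_pair P k (k + 1)) = card (level_pair Q k (k + 1))"
    using assms(3) iso_imp_card_eq unfolding poset_iso_def by blast
  then show ?thesis
    using labelled_tower.card_level_pair[OF labelled_tower.intro[OF assms(1)] assms(4)]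
      labelled_tower.card_level_pair[OF labelled_tower.intro[OF assms(2)] assms(4)]
    by (simp split: if_splits)
qed

section \<open>Classification and automorphisms\<close>

lemma poset_iso_refl: "P \<simeq> P"
proof -
  have "iso P P id" by (simp add: iso_iff2)
  then show ?thesis by (auto simp: poset_iso_def)
qed

lemma poset_iso_sym: "P \<simeq> Q \<Longrightarrow> Q \<simeq> P"
  unfolding poset_iso_def using iso_inverse by blast

lemma poset_iso_trans: "P \<simeq> Q \<Longrightarrow> Q \<simeq> R \<Longrightarrow> P \<simeq> R"
  unfolding poset_iso_def using comp_iso by blast

lemma N2_iso:
  assumes "P \<in> N2" "Q \<in> N2" "height P = height Q"
    and "\<forall>k \<in> {1..height P - 2}. level_pair P k (k + 1) \<simeq> level_pair Q k (k + 1)"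
  shows "P \<simeq> Q"
proof -
  from assms(1) obtain t e where P: "iso (tower (height P) t) P e" "t 0" "t (height P - 1)"
    by (rule N2_labelling)
  from assms(2) obtain t' e' where Q: "iso (tower (height P) t') Q e'" "t' 0" "t' (height P - 1)"
    unfolding assms(3) by (rule N2_labelling)
  have "t k = t' k" if "k < height P" for k
  proof (cases "k = 0 \<or> k = height P - 1")
    case False
    with that have "k \<in> {1..height P - 2}" by auto
    with assms(4) tower_type_determined[OF P(1) Q(1) _ that] show ?thesis by blast
  qed (use P Q in auto)
  then have "tower (height P) t = tower (height P) t'" by (rule tower_cong)
  with P(1) Q(1) have "tower (height P) t \<simeq> P" "tower (height P) t \<simeq> Q"
    by (auto simp: poset_iso_def)
  then show ?thesis by (meson poset_iso_sym poset_iso_trans)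
qed

lemma iso_map_prod:
  assumes "inj f"
  shows "iso R (map_prod f f ` R) f"
proof -
  have "Field (map_prod f f ` R) = f ` Field R" by (force simp: Field_def)
  moreover have "(a, b) \<in> R \<longleftrightarrow> (f a, f b) \<in> map_prod f f ` R" for a b
    using inj_eq[OF assms] by force
  ultimately show ?thesis
    using assms by (auto simp: iso_iff2 bij_betw_def inj_on_def)
qed

text \<open>
  The bottom and top pairs of a nice section are crowns in any case, so that only \<open>T \<inter> {1..n - 2}\<close>
  is free to choose.
\<close>

definition crowns_at :: "nat \<Rightarrow> nat set \<Rightarrow> nat \<Rightarrow> bool"
  where "crowns_at n T k \<longleftrightarrow> k = 0 \<or> k = n - 1 \<or> k \<in> T"

definition nat_tower :: "nat \<Rightarrow> nat set \<Rightarrow> nat rel"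
  where "nat_tower n T = map_prod prod_encode prod_encode ` tower n (crowns_at n T)"

lemma nat_tower_labelling: "iso (tower n (crowns_at n T)) (nat_tower n T) prod_encode"
  unfolding nat_tower_def by (rule iso_map_prod) (rule inj_prod_encode)

lemma nat_tower_in_N2:
  assumes "n \<ge> 2"
  shows "nat_tower n T \<in> N2" "height (nat_tower n T) = n"
proof -
  interpret labelled_tower "nat_tower n T" n "crowns_at n T" prod_encode
    by (rule labelled_tower.intro[OF nat_tower_labelling])
  show "nat_tower n T \<in> N2" "height (nat_tower n T) = n"
    using assms in_N2 height by (auto simp: crowns_at_def)
qed

text \<open>
  The towers with crowns at the positions in \<open>T\<close>, besides the bottom and the top, represent each
  isomorphism type exactly once as \<open>T\<close> runs through the subsets of \<open>{1..n - 2}\<close>.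
\<close>

lemma card_iso_types_N2:
  assumes "n \<ge> 2"
  shows "card (iso_types {P \<in> (N2 :: nat rel set). height P = n}) = 2 ^ (n - 2)"
proof -
  let ?class = "\<lambda>T. {Q :: nat rel. nat_tower n T \<simeq> Q}"
  have "iso_types {P \<in> (N2 :: nat rel set). height P = n} = ?class ` Pow {1..n - 2}"
  proof (intro equalityI subsetI)
    fix X assume "X \<in> ?class ` Pow {1..n - 2}"
    then obtain T where "X = {(P, Q). P \<simeq> Q} `` {nat_tower n T}" by auto
    moreover have "nat_tower n T \<in> {P \<in> N2. height P = n}" using nat_tower_in_N2[OF assms] by simp
    ultimately show "X \<in> iso_types {P \<in> (N2 :: nat rel set). height P = n}"
      unfolding iso_types_def by (simp only: quotientI)
  next
    fix X assume "X \<in> iso_types {P \<in> (N2 :: nat rel set). height P = n}"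
    then obtain P :: "nat rel" where "X = {(P, Q). P \<simeq> Q} `` {P}" and "P \<in> {P \<in> N2. height P = n}"
      unfolding iso_types_def by (rule quotientE)
    then have P: "P \<in> N2" "height P = n" and X: "X = {Q. P \<simeq> Q}" by auto
    from P(1) obtain t e where t: "iso (tower n t) P e" "t 0" "t (n - 1)"
      unfolding P(2)[symmetric] by (rule N2_labelling)
    define T where "T = {k \<in> {1..n - 2}. t k}"
    have "t k = crowns_at n T k" if "k < n" for k
      using t that unfolding crowns_at_def T_def by (cases "k = 0 \<or> k = n - 1") auto
    then have "tower n t = tower n (crowns_at n T)" by (rule tower_cong)
    with t(1) nat_tower_labelling[of n T] have "nat_tower n T \<simeq> P"
      by (metis poset_iso_def poset_iso_sym poset_iso_trans)
    then have "X = ?class T"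
      unfolding X by (auto intro: poset_iso_trans poset_iso_sym)
    moreover have "T \<in> Pow {1..n - 2}" by (auto simp: T_def)
    ultimately show "X \<in> ?class ` Pow {1..n - 2}" by blast
  qed
  moreover have "inj_on ?class (Pow {1..n - 2})"
  proof (rule inj_onI)
    fix S T assume ST: "S \<in> Pow {1..n - 2}" "T \<in> Pow {1..n - 2}" and eq: "?class S = ?class T"
    have "nat_tower n S \<simeq> nat_tower n T" using eq poset_iso_refl by blast
    then obtain g where "iso (nat_tower n S) (nat_tower n T) g" by (auto simp: poset_iso_def)
    with nat_tower_labelling have "iso (tower n (crowns_at n S)) (nat_tower n T) (g \<circ> prod_encode)"
      by (rule comp_iso)
    then have "crowns_at n S k = crowns_at n T k" if "k < n" for k
      using tower_type_determined[OF _ nat_tower_labelling poset_iso_refl that] by blast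
    moreover have "k < n" "k \<noteq> 0" "k \<noteq> n - 1" if "k \<in> {1..n - 2}" for k
      using that assms by auto
    ultimately have "k \<in> S \<longleftrightarrow> k \<in> T" if "k \<in> {1..n - 2}" for k
      using that unfolding crowns_at_def by blast
    with ST show "S = T" by blast
  qed
  ultimately show ?thesis by (simp add: card_image card_Pow)
qed

lemma iso_cong_on_Field:
  assumes "iso P Q f" "\<And>x. x \<in> Field P \<Longrightarrow> g x = f x"
  shows "iso P Q g"
proof -
  have "bij_betw g (Field P) (Field Q)"
    using assms bij_betw_cong[of "Field P" g f] by (simp add: iso_iff2)
  with assms show ?thesis by (simp add: iso_iff2)
qed

text \<open>
  A permutation of the bottom row is a permutation of the columns and acts on every row in the same
  way, which gives existence.  For uniqueness, composing an automorphism with a labelling gives another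
  labelling, and a labelling is determined by its bottom row.
\<close>

lemma N2_automorphism:
  assumes "P \<in> N2" "\<pi> permutes level P 0"
  shows "\<exists>!f. f permutes Field P \<and> iso P P f \<and> (\<forall>x \<in> level P 0. f x = \<pi> x)"
proof -
  from assms(1) obtain t e where "iso (tower (height P) t) P e" by (rule N2_labelling)
  then interpret labelled_tower P "height P" t e by (rule labelled_tower.intro)
  have level0: "level P 0 = row 0" by (rule level_eq_row) simp
  let ?b = "\<lambda>i. e (0, i)"
  have b: "bij_betw ?b {0, 1, 2} (level P 0)"
    unfolding level0
  proof (rule bij_betw_imageI[OF inj_onI])
    fix i j :: nat assume "i \<in> {0, 1, 2}" "j \<in> {0, 1, 2}" "e (0, i) = e (0, j)"
    then show "i = j" using row_eq_iff[of 0 0 i j] by simp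
  qed simp
  have "bij_betw (inv_into {0, 1, 2} ?b \<circ> (\<pi> \<circ> ?b)) {0, 1, 2} {0, 1, 2}"
    by (rule bij_betw_trans[OF bij_betw_trans[OF b permutes_imp_bij[OF assms(2)]]
          bij_betw_inv_into[OF b]])
  then obtain f where f: "iso P P f"
    "\<And>k i. (k, i) \<in> grid (height P) \<Longrightarrow> f (e (k, i)) = e (k, (inv_into {0, 1, 2} ?b \<circ> (\<pi> \<circ> ?b)) i)"
    by (rule extend_row_permutation) blast
  have f0: "f x = \<pi> x" if "x \<in> level P 0" for x
  proof -
    from that obtain i where i: "i \<in> {0, 1, 2}" "x = ?b i" unfolding level0 by blast
    then have "(0, i) \<in> grid (height P)" by (simp add: grid_def)
    then have "f x = ?b (inv_into {0, 1, 2} ?b (\<pi> x))" using f(2) i by simp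
    also have "\<dots> = \<pi> x"
      using bij_betw_inv_into_right[OF b] permutes_in_image[OF assms(2)] that by blast
    finally show ?thesis .
  qed
  have sub: "level P 0 \<subseteq> Field P" unfolding level0 Field_rows by (intro UN_upper) simp
  define g where "g x = (if x \<in> Field P then f x else x)" for x
  have g: "iso P P g" by (rule iso_cong_on_Field[OF f(1)]) (simp add: g_def)
  have "g permutes Field P"
    by (rule bij_imp_permutes) (use g in \<open>auto simp: iso_iff2 g_def\<close>)
  moreover have "\<forall>x \<in> level P 0. g x = \<pi> x" using f0 sub by (auto simp: g_def)
  moreover have "h = g" if h: "h permutes Field P" "iso P P h" "\<forall>x \<in> level P 0. h x = \<pi> x" for h
  proof
    fix x
    show "h x = g x"
    proof (cases "x \<in> Field P")
      case True
      then obtain k i where x: "x = e (k, i)" "(k, i) \<in> grid (height P)" unfolding Field by auto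
      have "(h \<circ> e) (k, i) = (g \<circ> e) (k, i)"
      proof (rule labelling_unique[OF comp_iso[OF labelling h(2)] comp_iso[OF labelling g] _ x(2)])
        fix i :: nat assume "i \<in> {0, 1, 2}"
        then have "e (0, i) \<in> level P 0" unfolding level0 by blast
        with h(3) \<open>\<forall>x \<in> level P 0. g x = \<pi> x\<close> show "(h \<circ> e) (0, i) = (g \<circ> e) (0, i)" by simp
      qed
      with x show ?thesis by simp
    next
      case False
      with h(1) show ?thesis by (simp add: g_def permutes_not_in)
    qed
  qed
  ultimately show ?thesis using g by (intro ex1I[of _ g]) blast+
qed

theorem theorem4p2:
  shows "(\<forall>P \<in> (N2 :: 'a rel set). \<forall>k \<in> {1..height P - 2}.
            six_crown (level_pair P k (k + 1)) \<or> type_3C (level_pair P k (k + 1))) \<and>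
         (\<forall>P \<in> (N2 :: 'a rel set). \<forall>Q \<in> (N2 :: 'b rel set).
            height P = height Q \<longrightarrow>
            (\<forall>k \<in> {1..height P - 2}. level_pair P k (k + 1) \<simeq> level_pair Q k (k + 1)) \<longrightarrow>
            P \<simeq> Q) \<and>
         (\<forall>n \<ge> 2. card (iso_types {P \<in> (N2 :: nat rel set). height P = n}) = 2 ^ (n - 2)) \<and>
         (\<forall>P \<in> (N2 :: 'a rel set). \<forall>\<pi>. \<pi> permutes level P 0 \<longrightarrow>
            (\<exists>!f. f permutes Field P \<and> iso P P f \<and> (\<forall>x \<in> level P 0. f x = \<pi> x)))"
proof (intro conjI ballI allI impI)
  fix P :: "'a rel" and k assume "P \<in> N2" "k \<in> {1..height P - 2}"
  then show "six_crown (level_pair P k (k + 1)) \<or> type_3C (level_pair P k (k + 1))"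
    by (intro N2_level_pair) auto
qed (use N2_iso card_iso_types_N2 N2_automorphism in blast)+

end
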